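(* Let $q>2$ and $n\ge1$ be integers, $h\in\{0,\ldots,n\}$, $\lambda=(q-1)n-qh$, and let $d$ be an integer with $0\le d\le h$. Suppose that $$\sum_{i=0}^{k} r^k_{i,d-k}\,P^{(q-1)}_i(l;k)\neq 0\qquad\text{for all } k=0,\ldots,d \text{ and } l=0,\ldots,k.$$ Then for every function $\varphi:W_d\to\mathbb{C}$, any $\lambda$-function $f$ with $f(\alpha)=\varphi(\alpha)$ for all $\alpha\in W_d$ has its values on $B_d$ uniquely determined by $\varphi$; that is, if $f,g$ are $\lambda$-functions with $f=g$ on $W_d$, then $f=g$ on $B_d$.
   Context: $\mathbf{F}_q=\{0,\ldots,q-1\}$ is the additive group of integers mod $q$; $\mathbf{F}_q^n$ is the vertex set of the $q$-ary Hamming graph (adjacency: differing in exactly one coordinate). $\rho$ is Hamming distance, $\mathbf{0}$ the zero vector, $W_i=\{\alpha:\rho(\alpha,\mathbf{0})=i\}$ and $B_i=\{\alpha:\rho(\alpha,\mathbf{0})\le i\}$; $W_1(\alpha)=\{\beta:\rho(\alpha,\beta)=1\}$. A $\lambda$-function is $f:\mathbf{F}_q^n\to\mathbb{C}$ with $\sum_{\beta\in W_1(\alpha)}f(\beta)=\lambda f(\alpha)$ for all $\alpha$. For $p\ge2$, $P^{(p)}_i(t;N)=\sum_{s=0}^{i}(-1)^s(p-1)^{i-s}\binom{t}{s}\binom{N-t}{i-s}$ (Krawtchouk polynomial); binomials with $b<0$ or $b>a\ge0$ are $0$ and empty sums are $0$. For $0\le k\le h$ and integers $i\ge0$, $0\le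 j\le n-k$, the coefficients $r^k_{ij}$ are: if $k\le n-h$, $r^k_{ij}=(-1)^i\sum_{l=0}^{j-i}P^{(q)}_{j-i-l}(h-k;n-2k)(q-2)^l\binom{k-i}{l}$; if $k>n-h$, let $U=(u_{ab})_{a,b=0}^{n-k}$ with $u_{ab}=(q-1)^{a-b}\binom{h+k-n}{a-b}$ (lower triangular, unit diagonal), $U^{-1}=(u'_{ab})$, and $r^k_{ij}=(-1)^i\sum_{s=i}^{j}u'_{js}P^{(q-1)}_{s-i}(h-k;h-i)$. (In both cases $r^k_{ij}=0$ for $i>j$.) *)

theory Defs
  imports Complex_Main
    "HOL-Library.FuncSet"
    "Jordan_Normal_Form.Determinant"
    "Jordan_Normal_Form.Gauss_Jordan_Elimination"
begin

text \<open>A vertex is an extensional function from the coordinates \<open>{..<n}\<close> to the alphabet \<open>{..<q}\<close>.\<close>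

definition hvert :: "nat \<Rightarrow> nat \<Rightarrow> (nat \<Rightarrow> nat) set" where
  "hvert q n = {..<n} \<rightarrow>\<^sub>E {..<q}"

definition hzero :: "nat \<Rightarrow> nat \<Rightarrow> nat" where
  "hzero n = (\<lambda>i\<in>{..<n}. 0)"

definition hdist :: "nat \<Rightarrow> (nat \<Rightarrow> nat) \<Rightarrow> (nat \<Rightarrow> nat) \<Rightarrow> nat" where
  "hdist n \<alpha> \<beta> = card {i \<in> {..<n}. \<alpha> i \<noteq> \<beta> i}"

definition hsphere :: "nat \<Rightarrow> nat \<Rightarrow> nat \<Rightarrow> (nat \<Rightarrow> nat) \<Rightarrow> (nat \<Rightarrow> nat) set" where
  "hsphere q n i \<alpha> = {\<beta> \<in> hvert q n. hdist n \<alpha> \<beta> = i}"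

definition hball :: "nat \<Rightarrow> nat \<Rightarrow> nat \<Rightarrow> (nat \<Rightarrow> nat) \<Rightarrow> (nat \<Rightarrow> nat) set" where
  "hball q n i \<alpha> = {\<beta> \<in> hvert q n. hdist n \<alpha> \<beta> \<le> i}"

text \<open>The values of \<open>f\<close> outside \<open>hvert q n\<close> are irrelevant. The zero function is allowed.\<close>

definition lambda_function :: "nat \<Rightarrow> nat \<Rightarrow> complex \<Rightarrow> ((nat \<Rightarrow> nat) \<Rightarrow> complex) \<Rightarrow> bool" where
  "lambda_function q n lam f \<longleftrightarrow>
     (\<forall>\<alpha>\<in>hvert q n. (\<Sum>\<beta>\<in>hsphere q n 1 \<alpha>. f \<beta>) = lam * f \<alpha>)"

text \<open>
  All arguments \<open>t\<close> and \<open>N\<close> below are integers, embedded into \<open>complex\<close> so that differences such as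
  \<open>N - t\<close> are not truncated; \<open>of_nat a gchoose b = of_nat (a choose b)\<close>, which is \<open>0\<close> for \<open>a < b\<close>.
\<close>

definition krawtchouk :: "nat \<Rightarrow> nat \<Rightarrow> complex \<Rightarrow> complex \<Rightarrow> complex" where
  "krawtchouk p i t N =
     (\<Sum>s=0..i. (-1) ^ s * (of_nat p - 1) ^ (i - s) * (t gchoose s) * ((N - t) gchoose (i - s)))"

text \<open>
  Only used for \<open>h + k > n\<close>. The entries above the diagonal vanish; the case distinction is needed
  because \<open>a - b\<close> is truncated there.
\<close>

definition umat :: "nat \<Rightarrow> nat \<Rightarrow> nat \<Rightarrow> nat \<Rightarrow> complex mat" where
  "umat q n h k = mat (n - k + 1) (n - k + 1)
     (\<lambda>(a, b). if b \<le> a then (of_nat q - 1) ^ (a - b) * of_nat ((h + k - n) choose (a - b)) else 0)"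

definition umat_inv :: "nat \<Rightarrow> nat \<Rightarrow> nat \<Rightarrow> nat \<Rightarrow> complex mat" where
  "umat_inv q n h k = the (mat_inverse (umat q n h k))"

text \<open>The value \<open>None\<close> never occurs in the definition above.\<close>

lemma umat_inv:
  shows "umat_inv q n h k \<in> carrier_mat (n - k + 1) (n - k + 1)"
    and "umat q n h k * umat_inv q n h k = 1\<^sub>m (n - k + 1)"
    and "umat_inv q n h k * umat q n h k = 1\<^sub>m (n - k + 1)"
proof -
  let ?U = "umat q n h k" and ?m = "n - k + 1"
  have U: "?U \<in> carrier_mat ?m ?m"
    by (simp add: umat_def)
  have "det ?U = prod_list (diag_mat ?U)"
    by (rule det_lower_triangular[OF _ U]) (auto simp: umat_def)
  also have "diag_mat ?U = map (\<lambda>_. 1) [0..<?m]"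
    unfolding diag_mat_def by (rule map_cong) (auto simp: umat_def)
  also have "prod_list \<dots> = (1 :: complex)"
    by (simp only: map_replicate_const prod_list_replicate power_one)
  finally have "det ?U \<noteq> 0" by simp
  then have "?U \<in> Units (ring_mat TYPE(complex) ?m ())"
    by (rule det_non_zero_imp_unit[OF U])
  then obtain V where "mat_inverse ?U = Some V"
    using mat_inverse(1)[OF U, where b = "()"] by (cases "mat_inverse ?U") auto
  then show "umat_inv q n h k \<in> carrier_mat ?m ?m" "?U * umat_inv q n h k = 1\<^sub>m ?m"
    "umat_inv q n h k * ?U = 1\<^sub>m ?m"
    using mat_inverse(2)[OF U] by (simp_all add: umat_inv_def)
qed

text \<open>
  In \<open>rcoef q n h k i j\<close> the upper index is \<open>k\<close> and the lower indices are \<open>i\<close> and \<open>j\<close>.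
  It is meaningful for \<open>k \<le> h \<le> n\<close> and \<open>j \<le> n - k\<close>.
\<close>

definition rcoef :: "nat \<Rightarrow> nat \<Rightarrow> nat \<Rightarrow> nat \<Rightarrow> nat \<Rightarrow> nat \<Rightarrow> complex" where
  "rcoef q n h k i j =
     (if i > j then 0
      else if k \<le> n - h then
        (-1) ^ i * (\<Sum>l=0..j - i.
          krawtchouk q (j - i - l) (of_nat h - of_nat k) (of_nat n - 2 * of_nat k)
          * (of_nat q - 2) ^ l * ((of_nat k - of_nat i) gchoose l))
      else
        (-1) ^ i * (\<Sum>s=i..j.
          umat_inv q n h k $$ (j, s)
          * krawtchouk (q - 1) (s - i) (of_nat h - of_nat k) (of_nat h - of_nat i)))"

end

theory Submission
  imports Defs
begin

text \<open>
  Let \<open>u\<close> be the difference of the two functions. Fourier transform on \<open>F_q^n\<close> shows that the spectrum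
  of \<open>u\<close> lies in weight \<open>h\<close>. Fix a set \<open>J\<close> of \<open>k\<close> coordinates and a vertex \<open>\<alpha>\<close>. Let \<open>V_j\<close> be the sum of \<open>u\<close> over
  the vertices at distance \<open>j\<close> from \<open>\<alpha>\<close> that agree with \<open>\<alpha>\<close> on \<open>J\<close>, and \<open>S_i\<close> the sum over those at distance
  \<open>i\<close> that agree with \<open>\<alpha>\<close> off \<open>J\<close>. The kernels of the generating functions \<open>\<Sum>j. V_j x^j\<close> and
  \<open>\<Sum>i. S_i (-x)^i (1 + (q - 2) x)^(k - i)\<close> are products over the coordinates, hence diagonal on the
  characters. Comparing eigenvalues, the two differ by the factor
  \<open>(1 - x)^(h - k) (1 + (q - 1) x)^(n - h - k)\<close>, that is, \<open>V_j = \<Sum>i. r_ij S_i\<close>.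

  By induction on \<open>k\<close>, suppose that \<open>u\<close> vanishes in weights below \<open>k\<close>, and let \<open>\<alpha>\<close> have support \<open>J\<close>. All
  vertices counted in \<open>V_(d-k)\<close> lie in \<open>W_d\<close>, so \<open>\<Sum>i. r_i(d-k) S_i = 0\<close>, and only vertices of
  support exactly \<open>J\<close> contribute to \<open>S_i\<close>. These form a Hamming graph \<open>H(k, q - 1)\<close>, on which
  the operator \<open>\<Sum>i. r_i(d-k) A_i\<close> has the eigenvalues assumed nonzero; so \<open>u\<close> vanishes there.
\<close>

section \<open>Characters and Fourier inversion on cubes\<close>

text \<open>The coordinate set and the alphabet are parameters because two graphs occur: all
  coordinates with \<open>q\<close> letters, and a support \<open>J\<close> with
  \<open>q - 1\<close> letters.\<close>

definition cube :: "'a set \<Rightarrow> nat \<Rightarrow> ('a \<Rightarrow> nat) set" where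
  "cube D p = D \<rightarrow>\<^sub>E {..<p}"

lemma finite_cube: "finite D \<Longrightarrow> finite (cube D p)"
  by (simp add: cube_def finite_PiE)

definition dist_on :: "'a set \<Rightarrow> ('a \<Rightarrow> nat) \<Rightarrow> ('a \<Rightarrow> nat) \<Rightarrow> nat" where
  "dist_on D \<alpha> \<beta> = card {i \<in> D. \<alpha> i \<noteq> \<beta> i}"

definition wt_on :: "'a set \<Rightarrow> ('a \<Rightarrow> nat) \<Rightarrow> nat" where
  "wt_on D z = card {i \<in> D. z i \<noteq> 0}"

definition zeta :: "nat \<Rightarrow> complex" where
  "zeta p = cis (2 * pi / real p)"

definition chr :: "'a set \<Rightarrow> nat \<Rightarrow> ('a \<Rightarrow> nat) \<Rightarrow> ('a \<Rightarrow> nat) \<Rightarrow> complex" where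
  "chr D p z \<alpha> = (\<Prod>i\<in>D. zeta p ^ (z i * \<alpha> i))"

definition fourier :: "'a set \<Rightarrow> nat \<Rightarrow> (('a \<Rightarrow> nat) \<Rightarrow> complex) \<Rightarrow> ('a \<Rightarrow> nat) \<Rightarrow> complex" where
  "fourier D p f z = (\<Sum>\<alpha>\<in>cube D p. f \<alpha> * chr D p z \<alpha>)"

lemma dist_on_commute: "dist_on D \<alpha> \<beta> = dist_on D \<beta> \<alpha>"
  unfolding dist_on_def by (rule arg_cong[of _ _ card]) auto

lemma dist_on_le_card: "finite D \<Longrightarrow> dist_on D \<alpha> \<beta> \<le> card D"
  by (simp add: dist_on_def card_mono)

lemma wt_on_le_card: "finite D \<Longrightarrow> wt_on D z \<le> card D"
  by (simp add: wt_on_def card_mono)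

lemma zeta_power: "zeta p ^ m = cis (2 * pi * real m / real p)"
  by (simp add: zeta_def DeMoivre mult_ac)

lemma zeta_power_self: "p > 0 \<Longrightarrow> zeta p ^ p = 1"
  by (simp add: zeta_power cis_2pi)

lemma zeta_power_inj: "p > 0 \<Longrightarrow> a < p \<Longrightarrow> b < p \<Longrightarrow> zeta p ^ a = zeta p ^ b \<longleftrightarrow> a = b"
  using bij_betw_roots_unity[of p] unfolding zeta_power bij_betw_def inj_on_def by fastforce

lemma zeta_cnj: "zeta p * cnj (zeta p) = 1"
  by (simp add: zeta_def cis_cnj cis_mult)

lemma sum_powers_root_of_unity:
  fixes r :: complex
  assumes "r ^ p = 1"
  shows "(\<Sum>a<p. r ^ a) = (if r = 1 then of_nat p else 0)"
  using assms by (simp add: geometric_sum)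

text \<open>The summand is the \<open>z\<close>-th power of the root of unity
  \<open>zeta p ^ a * cnj (zeta p) ^ b\<close>, which is 1 only if \<open>a = b\<close> because
  \<open>zeta p\<close> is primitive.\<close>

lemma zeta_orthogonal:
  assumes "a < p" "b < p"
  shows "(\<Sum>z<p. zeta p ^ (z * a) * cnj (zeta p) ^ (z * b)) = (if a = b then of_nat p else 0)"
proof -
  define r where "r = zeta p ^ a * cnj (zeta p) ^ b"
  have p: "p > 0" using assms by simp
  have "r ^ p = (zeta p ^ p) ^ a * cnj (zeta p ^ p) ^ b"
    by (simp add: r_def power_mult_distrib flip: power_mult) (simp add: mult.commute)
  also have "\<dots> = 1" by (simp add: zeta_power_self p)
  finally have rp: "r ^ p = 1" .
  have "r = 1 \<longleftrightarrow> zeta p ^ a = zeta p ^ b"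
  proof -
    have *: "zeta p ^ b * cnj (zeta p) ^ b = 1"
      by (simp add: zeta_cnj flip: power_mult_distrib)
    show ?thesis
    proof
      assume "r = 1"
      then have "zeta p ^ a * (zeta p ^ b * cnj (zeta p) ^ b) = zeta p ^ b"
        by (simp add: r_def mult_ac)
      then show "zeta p ^ a = zeta p ^ b" by (simp add: *)
    qed (simp add: r_def *)
  qed
  then have r1: "r = 1 \<longleftrightarrow> a = b" using zeta_power_inj[OF p assms] by simp
  have "(\<Sum>z<p. zeta p ^ (z * a) * cnj (zeta p) ^ (z * b)) = (\<Sum>z<p. r ^ z)"
    by (simp add: r_def power_mult_distrib flip: power_mult) (simp add: mult.commute)
  then show ?thesis by (simp add: sum_powers_root_of_unity[OF rp] r1)
qed

text \<open>Fourier inversion: by orthogonality of characters, pairing the transform with the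
  conjugate characters at \<open>\<gamma>\<close> returns \<open>f \<gamma>\<close> times
  \<open>p ^ card D\<close>.\<close>

lemma fourier_inj:
  assumes D: "finite D" and 0: "\<And>z. z \<in> cube D p \<Longrightarrow> fourier D p f z = 0"
    and \<gamma>: "\<gamma> \<in> cube D p"
  shows "f \<gamma> = 0"
proof -
  have ort: "(\<Sum>z\<in>cube D p. chr D p z \<alpha> * cnj (chr D p z \<gamma>)) = (if \<alpha> = \<gamma> then of_nat p ^ card D else 0)"
    if \<alpha>: "\<alpha> \<in> cube D p" for \<alpha>
  proof -
    have "(\<Sum>z\<in>cube D p. chr D p z \<alpha> * cnj (chr D p z \<gamma>))
        = (\<Sum>z\<in>cube D p. \<Prod>i\<in>D. zeta p ^ (z i * \<alpha> i) * cnj (zeta p) ^ (z i * \<gamma> i))"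
      by (simp add: chr_def prod.distrib)
    also have "\<dots> = (\<Prod>i\<in>D. \<Sum>z<p. zeta p ^ (z * \<alpha> i) * cnj (zeta p) ^ (z * \<gamma> i))"
      unfolding cube_def by (rule prod_sum_PiE[symmetric]) (use D in auto)
    also have "\<dots> = (\<Prod>i\<in>D. if \<alpha> i = \<gamma> i then of_nat p else 0)"
      by (rule prod.cong[OF refl], rule zeta_orthogonal) (use \<alpha> \<gamma> in \<open>auto simp: cube_def\<close>)
    also have "\<dots> = (if \<alpha> = \<gamma> then of_nat p ^ card D else 0)"
    proof (cases "\<alpha> = \<gamma>")
      case False
      then obtain i where "i \<in> D" "\<alpha> i \<noteq> \<gamma> i"
        using \<alpha> \<gamma> unfolding cube_def by (metis PiE_ext)
      then have "(\<Prod>i\<in>D. if \<alpha> i = \<gamma> i then of_nat p else (0::complex)) = 0"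
        using D by (auto intro!: prod_zero)
      with False show ?thesis by simp
    qed simp
    finally show ?thesis .
  qed
  have "0 = (\<Sum>z\<in>cube D p. fourier D p f z * cnj (chr D p z \<gamma>))"
    by (simp add: 0)
  also have "\<dots> = (\<Sum>\<alpha>\<in>cube D p. f \<alpha> * (\<Sum>z\<in>cube D p. chr D p z \<alpha> * cnj (chr D p z \<gamma>)))"
    unfolding fourier_def sum_distrib_left sum_distrib_right mult.assoc by (rule sum.swap)
  also have "\<dots> = (\<Sum>\<alpha>\<in>cube D p. if \<alpha> = \<gamma> then f \<alpha> * of_nat p ^ card D else 0)"
    by (rule sum.cong) (auto simp: ort)
  also have "\<dots> = f \<gamma> * of_nat p ^ card D"
    using \<gamma> by (simp add: finite_cube[OF D])
  finally show ?thesis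
  proof -
    assume e: "0 = f \<gamma> * of_nat p ^ card D"
    \<comment> \<open>If \<open>p = 0\<close>, the cube contains \<open>\<gamma>\<close> only when
      \<open>D\<close> is empty, and then the power is 1.\<close>
    have "of_nat p ^ card D \<noteq> (0::complex)"
    proof (cases "D = {}")
      case False
      then have "p > 0" using \<gamma> by (auto simp: cube_def PiE_def Pi_def)
      then show ?thesis by simp
    qed simp
    then show ?thesis using e by (metis mult_eq_0_iff)
  qed
qed

section \<open>Product kernels and their eigenvalues\<close>

text \<open>The sum factors over the coordinates. In coordinate \<open>i\<close> the kernel is
  \<open>u i - v i\<close> times the identity plus \<open>v i\<close> times the all-ones matrix, and
  the latter has eigenvalue \<open>p\<close> on the trivial character and 0 on all others.\<close>

lemma chr_product_kernel:
  assumes D: "finite D" and z: "z \<in> cube D p" and \<beta>: "\<beta> \<in> cube D p"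
  shows "(\<Sum>\<alpha>\<in>cube D p. (\<Prod>i\<in>D. if \<alpha> i = \<beta> i then u i else v i) * chr D p z \<alpha>)
       = (\<Prod>i\<in>D. if z i = 0 then u i + (of_nat p - 1) * v i else u i - v i) * chr D p z \<beta>"
proof -
  have "(\<Sum>\<alpha>\<in>cube D p. (\<Prod>i\<in>D. if \<alpha> i = \<beta> i then u i else v i) * chr D p z \<alpha>)
     = (\<Sum>\<alpha>\<in>cube D p. \<Prod>i\<in>D. (if \<alpha> i = \<beta> i then u i else v i) * zeta p ^ (z i * \<alpha> i))"
    by (simp add: chr_def prod.distrib)
  also have "\<dots> = (\<Prod>i\<in>D. \<Sum>a<p. (if a = \<beta> i then u i else v i) * zeta p ^ (z i * a))"
    unfolding cube_def by (rule prod_sum_PiE[symmetric]) (use D in auto)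
  also have "\<dots> = (\<Prod>i\<in>D. (if z i = 0 then u i + (of_nat p - 1) * v i else u i - v i) * zeta p ^ (z i * \<beta> i))"
  proof (rule prod.cong[OF refl])
    fix i assume "i \<in> D"
    then have zi: "z i < p" and bi: "\<beta> i < p" using z \<beta> by (auto simp: cube_def)
    have s: "(\<Sum>a<p. zeta p ^ (z i * a)) = (if z i = 0 then of_nat p else 0)"
      by (subst mult.commute) (use zeta_orthogonal[of "z i" p 0] zi in simp)
    have "(\<Sum>a<p. (if a = \<beta> i then u i else v i) * zeta p ^ (z i * a))
        = (\<Sum>a<p. (if a = \<beta> i then (u i - v i) * zeta p ^ (z i * a) else 0) + v i * zeta p ^ (z i * a))"
      by (rule sum.cong) (auto simp: algebra_simps)
    also have "\<dots> = (u i - v i) * zeta p ^ (z i * \<beta> i) + v i * (\<Sum>a<p. zeta p ^ (z i * a))"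
      using bi by (simp add: sum.distrib sum_distrib_left)
    also have "\<dots> = (if z i = 0 then u i + (of_nat p - 1) * v i else u i - v i) * zeta p ^ (z i * \<beta> i)"
      unfolding s by (simp add: algebra_simps)
    finally show "(\<Sum>a<p. (if a = \<beta> i then u i else v i) * zeta p ^ (z i * a))
       = (if z i = 0 then u i + (of_nat p - 1) * v i else u i - v i) * zeta p ^ (z i * \<beta> i)" .
  qed
  finally show ?thesis by (simp add: chr_def prod.distrib)
qed

lemma fourier_diff_scale:
  "fourier D p (\<lambda>\<alpha>. a * F \<alpha> - b * G \<alpha>) z = a * fourier D p F z - b * fourier D p G z"
  by (simp add: fourier_def sum_subtractf sum_distrib_left left_diff_distrib mult.assoc)

text \<open>Interchanging the sums moves \<open>K\<close> onto the character, an eigenvector of its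
  transpose.\<close>

lemma fourier_kernel:
  assumes "finite D"
    and "\<And>\<beta>. \<beta> \<in> cube D p \<Longrightarrow> (\<Sum>\<alpha>\<in>cube D p. K \<alpha> \<beta> * chr D p z \<alpha>) = e * chr D p z \<beta>"
  shows "fourier D p (\<lambda>\<alpha>. \<Sum>\<beta>\<in>cube D p. K \<alpha> \<beta> * f \<beta>) z = e * fourier D p f z"
proof -
  have "fourier D p (\<lambda>\<alpha>. \<Sum>\<beta>\<in>cube D p. K \<alpha> \<beta> * f \<beta>) z
      = (\<Sum>\<beta>\<in>cube D p. \<Sum>\<alpha>\<in>cube D p. K \<alpha> \<beta> * f \<beta> * chr D p z \<alpha>)"
    unfolding fourier_def sum_distrib_right by (rule sum.swap)
  also have "\<dots> = (\<Sum>\<beta>\<in>cube D p. f \<beta> * (\<Sum>\<alpha>\<in>cube D p. K \<alpha> \<beta> * chr D p z \<alpha>))"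
    by (simp add: sum_distrib_left mult_ac)
  also have "\<dots> = (\<Sum>\<beta>\<in>cube D p. f \<beta> * (e * chr D p z \<beta>))"
    by (rule sum.cong) (simp_all add: assms)
  finally show ?thesis by (simp add: fourier_def sum_distrib_left mult_ac)
qed

section \<open>Krawtchouk polynomials and sphere sums\<close>

lemma coeff_one_linear_power:
  "coeff ([:1, c:] ^ n) m = c ^ m * (of_nat n gchoose m)" for c :: complex
proof (cases "m \<le> n")
  case True
  then show ?thesis by (simp add: coeff_linear_poly_power binomial_gbinomial)
next
  case False
  then have "degree ([:1, c:] ^ n) < m"
    using degree_power_le[of "[:1, c:]" n] degree_pCons_le[of 1 "[:c:]"] 
    by (auto intro: le_less_trans)
  then show ?thesis using False
    by (simp add: coeff_eq_0 flip: binomial_gbinomial)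
qed

text \<open>The generating function of the Krawtchouk polynomials is
  \<open>(1 - x) ^ t * (1 + (p - 1) * x) ^ (N - t)\<close>. \<open>N\<close> is complex so that
  differences can be inserted untruncated; the assumption makes the second exponent a natural
  number.\<close>

lemma krawtchouk_eq_coeff:
  assumes "N - of_nat a = (of_nat b :: complex)"
  shows "krawtchouk p m (of_nat a) N = coeff ([:1, -1:] ^ a * [:1, of_nat p - 1:] ^ b) m"
  unfolding krawtchouk_def coeff_mult coeff_one_linear_power assms
  by (rule sum.cong) (auto simp: mult_ac)

text \<open>Passing to generating polynomials lets all sphere sums be treated at once: identities
  are proved at each \<open>x\<close> and then read off coefficientwise.\<close>

lemma sum_sphere_power:
  assumes D: "finite D"
  shows "(\<Sum>\<alpha>\<in>cube D p. x ^ dist_on D \<alpha> \<beta> * G \<alpha>)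
     = poly (\<Sum>m\<le>card D. monom (\<Sum>\<alpha> | \<alpha> \<in> cube D p \<and> dist_on D \<alpha> \<beta> = m. G \<alpha>) m) (x::complex)"
proof -
  have "(\<Sum>\<alpha>\<in>cube D p. x ^ dist_on D \<alpha> \<beta> * G \<alpha>)
      = (\<Sum>m\<le>card D. \<Sum>\<alpha> | \<alpha> \<in> cube D p \<and> dist_on D \<alpha> \<beta> = m. x ^ dist_on D \<alpha> \<beta> * G \<alpha>)"
    by (rule sum.group[symmetric]) (auto simp: finite_cube D dist_on_le_card)
  also have "\<dots> = (\<Sum>m\<le>card D. (\<Sum>\<alpha> | \<alpha> \<in> cube D p \<and> dist_on D \<alpha> \<beta> = m. G \<alpha>) * x ^ m)"
    unfolding sum_distrib_right by (intro sum.cong) auto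
  finally show ?thesis by (simp add: poly_sum poly_monom)
qed

lemma prod_if_const:
  "finite D \<Longrightarrow> (\<Prod>i\<in>D. if P i then a else b) = a ^ card {i\<in>D. P i} * b ^ card {i\<in>D. \<not> P i}"
  for a b :: "'b::comm_monoid_mult"
  by (simp add: prod.If_cases Int_def Compl_eq)

lemma card_zeros: "finite D \<Longrightarrow> card {i\<in>D. z i = 0} = card D - wt_on D z"
proof -
  assume D: "finite D"
  have "{i\<in>D. z i = 0} = D - {i\<in>D. z i \<noteq> 0}" by auto
  then show ?thesis using D by (simp add: wt_on_def card_Diff_subset)
qed

lemma coeff_sum_monom:
  "coeff (\<Sum>m\<le>N. monom (a m) m) j = (if j \<le> N then a j else 0)"
  by (simp add: coeff_sum if_distrib cong: if_cong)

text \<open>Weighting by \<open>x\<close> to the distance is a product kernel with factor 1 for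
  agreement and \<open>x\<close> for disagreement. Its eigenvalue is the Krawtchouk generating
  function at the weight of \<open>z\<close>, so comparing coefficients gives the claim.\<close>

lemma sphere_sum_chr:
  assumes D: "finite D" and z: "z \<in> cube D p" and \<beta>: "\<beta> \<in> cube D p" and m: "m \<le> card D"
  shows "(\<Sum>\<alpha> | \<alpha> \<in> cube D p \<and> dist_on D \<alpha> \<beta> = m. chr D p z \<alpha>)
     = krawtchouk p m (of_nat (wt_on D z)) (of_nat (card D)) * chr D p z \<beta>"
proof -
  let ?w = "wt_on D z" and ?N = "card D"
  let ?L = "\<Sum>m\<le>card D. monom (\<Sum>\<alpha> | \<alpha> \<in> cube D p \<and> dist_on D \<alpha> \<beta> = m. chr D p z \<alpha>) m"
  let ?R = "smult (chr D p z \<beta>) ([:1, -1:] ^ ?w * [:1, of_nat p - 1:] ^ (?N - ?w))"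
  have *: "poly ?L x = poly ?R x" for x
  proof -
    have "poly ?L x = (\<Sum>\<alpha>\<in>cube D p. x ^ dist_on D \<alpha> \<beta> * chr D p z \<alpha>)"
      by (rule sum_sphere_power[OF D, symmetric])
    also have "\<dots> = (\<Sum>\<alpha>\<in>cube D p. (\<Prod>i\<in>D. if \<alpha> i = \<beta> i then 1 else x) * chr D p z \<alpha>)"
      by (simp add: prod_if_const D dist_on_def)
    also have "\<dots> = (\<Prod>i\<in>D. if z i = 0 then 1 + (of_nat p - 1) * x else 1 - x) * chr D p z \<beta>"
      by (rule chr_product_kernel[OF D z \<beta>])
    also have "\<dots> = poly ?R x"
      using card_zeros[OF D, of z] by (simp add: prod_if_const D mult_ac wt_on_def)
    finally show ?thesis .
  qed
  have "?L = ?R"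
    by (rule iffD1[OF poly_eq_poly_eq_iff], rule ext, rule *)
  then have "coeff ?L m = coeff ?R m" by simp
  then show ?thesis
    using m wt_on_le_card[OF D, of z]
    by (subst krawtchouk_eq_coeff[where b = "?N - ?w"]) (simp_all add: coeff_sum_monom of_nat_diff mult_ac)
qed

text \<open>With \<open>A_i\<close> the distance-\<open>i\<close> matrix,
  \<open>\<Sum>i. c i * A_i\<close> is diagonal on characters, and \<open>ev\<close> says that no
  eigenvalue, indexed by the weight \<open>l\<close>, is zero. So the transform of \<open>F\<close>
  vanishes.\<close>

lemma sphere_combination_inj:
  assumes D: "finite D"
    and ev: "\<And>l. l \<le> card D \<Longrightarrow> (\<Sum>i\<le>card D. c i * krawtchouk p i (of_nat l) (of_nat (card D))) \<noteq> 0"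
    and F: "\<And>\<alpha>. \<alpha> \<in> cube D p \<Longrightarrow>
      (\<Sum>i\<le>card D. c i * (\<Sum>\<beta> | \<beta> \<in> cube D p \<and> dist_on D \<alpha> \<beta> = i. F \<beta>)) = 0"
    and \<gamma>: "\<gamma> \<in> cube D p"
  shows "F \<gamma> = 0"
proof (rule fourier_inj[OF D _ \<gamma>])
  fix z assume z: "z \<in> cube D p"
  let ?K = "\<lambda>\<alpha> \<beta>. c (dist_on D \<alpha> \<beta>)"
  let ?e = "\<Sum>i\<le>card D. c i * krawtchouk p i (of_nat (wt_on D z)) (of_nat (card D))"
  have group: "(\<Sum>\<alpha>\<in>cube D p. c (dist_on D \<alpha> \<beta>) * G \<alpha>)
      = (\<Sum>i\<le>card D. c i * (\<Sum>\<alpha> | \<alpha> \<in> cube D p \<and> dist_on D \<alpha> \<beta> = i. G \<alpha>))" for G \<beta>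
  proof -
    have "(\<Sum>\<alpha>\<in>cube D p. c (dist_on D \<alpha> \<beta>) * G \<alpha>)
      = (\<Sum>i\<le>card D. \<Sum>\<alpha> | \<alpha> \<in> cube D p \<and> dist_on D \<alpha> \<beta> = i. c (dist_on D \<alpha> \<beta>) * G \<alpha>)"
      by (rule sum.group[symmetric]) (auto simp: finite_cube D dist_on_le_card)
    also have "\<dots> = (\<Sum>i\<le>card D. c i * (\<Sum>\<alpha> | \<alpha> \<in> cube D p \<and> dist_on D \<alpha> \<beta> = i. G \<alpha>))"
      unfolding sum_distrib_left by (intro sum.cong) auto
    finally show ?thesis .
  qed
  have "fourier D p (\<lambda>\<alpha>. \<Sum>\<beta>\<in>cube D p. ?K \<alpha> \<beta> * F \<beta>) z = ?e * fourier D p F z"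
    by (rule fourier_kernel[OF D])
      (simp add: group sphere_sum_chr[OF D z] sum_distrib_right mult.assoc)
  moreover have "fourier D p (\<lambda>\<alpha>. \<Sum>\<beta>\<in>cube D p. ?K \<alpha> \<beta> * F \<beta>) z = 0"
  proof -
    have "(\<Sum>\<beta>\<in>cube D p. ?K \<alpha> \<beta> * F \<beta>) = 0" if "\<alpha> \<in> cube D p" for \<alpha>
      using F[OF that] group[of \<alpha> F] by (simp add: dist_on_commute)
    then show ?thesis by (simp add: fourier_def)
  qed
  ultimately show "fourier D p F z = 0"
    using ev[OF wt_on_le_card[OF D, of z]] by simp
qed

section \<open>The coefficients r from a polynomial identity\<close>

text \<open>Forward substitution: in entry \<open>(j, s)\<close> of \<open>U * U^-1 = 1\<close>,
  terms with \<open>b > j\<close> vanish by triangularity of \<open>U\<close> and those with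
  \<open>b < j\<close> by induction, leaving the unit diagonal entry times the entry in
  question.\<close>

lemma umat_inv_above_diagonal:
  assumes "j < s" "s \<le> n - k"
  shows "umat_inv q n h k $$ (j, s) = 0"
  using assms(1)
proof (induction j rule: less_induct)
  case (less j)
  let ?U = "umat q n h k" and ?I = "umat_inv q n h k" and ?N = "n - k + 1"
  have Uc: "?U \<in> carrier_mat ?N ?N" by (simp add: umat_def)
  have j: "j < ?N" and s: "s < ?N" using less.prems assms(2) by simp_all
  have "(?U * ?I) $$ (j, s) = 0"
    using j s less.prems by (simp add: umat_inv(2))
  moreover have "(?U * ?I) $$ (j, s) = (\<Sum>b<?N. ?U $$ (j, b) * ?I $$ (b, s))"
    using j s Uc umat_inv(1)[of q n h k]
    by (auto simp: scalar_prod_def lessThan_atLeast0 intro!: sum.cong)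
  moreover have "\<dots> = (\<Sum>b\<in>{j}. ?U $$ (j, b) * ?I $$ (b, s))"
  proof (rule sum.mono_neutral_right)
    show "\<forall>b\<in>{..<?N} - {j}. ?U $$ (j, b) * ?I $$ (b, s) = 0"
    proof
      fix b assume b: "b \<in> {..<?N} - {j}"
      show "?U $$ (j, b) * ?I $$ (b, s) = 0"
      proof (cases "b < j")
        case True
        then show ?thesis using less.IH[of b] less.prems by simp
      next
        case False
        then show ?thesis using b j by (simp add: umat_def)
      qed
    qed
  qed (use j in auto)
  ultimately show ?case using j by (simp add: umat_def)
qed

text \<open>
  The coefficients \<open>r\<close> arise by cancelling the common factors of the two sides. If \<open>k > n - h\<close>, the
  factor \<open>(1 + (q - 1) x) ^ (h + k - n)\<close> remains on the left; \<open>umat\<close> is the multiplication by it,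
  truncated at degree \<open>n - k\<close>.
\<close>

lemma rcoef_solve:
  fixes V S :: "nat \<Rightarrow> complex"
  assumes "q \<ge> 1" and kh: "k \<le> h" and hn: "h \<le> n" and j: "j \<le> n - k"
    and eq: "([:1, -1:] * [:1, of_nat q - 1:]) ^ k * (\<Sum>m\<le>n. monom (V m) m)
      = [:1, -1:] ^ h * [:1, of_nat q - 1:] ^ (n - h)
        * (\<Sum>i\<le>k. smult (S i) (monom ((-1) ^ i) i * [:1, of_nat q - 2:] ^ (k - i)))"
  shows "V j = (\<Sum>i\<le>k. rcoef q n h k i j * S i)"
proof -
  let ?A = "[:1, -1:] :: complex poly" and ?B = "[:1, of_nat q - 1:] :: complex poly"
    and ?C = "[:1, of_nat q - 2:] :: complex poly"
  let ?V = "\<Sum>m\<le>n. monom (V m) m"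
  have A0: "?A \<noteq> 0" and B0: "?B \<noteq> 0" by simp_all
  have Ah: "?A ^ h = ?A ^ k * ?A ^ (h - k)"
    using kh by (subst power_add[symmetric]) simp
  have jn: "j \<le> n" using j by simp
  \<comment> \<open>\<open>P\<close> stands for the prefactor that remains after cancelling. The
    monomial shifts the index by \<open>i\<close>, so only \<open>i \<le> m\<close>
    contributes.\<close>
  have trm: "coeff (P * (\<Sum>i\<le>k. smult (S i) (monom ((-1) ^ i) i * ?C ^ (k - i)))) m
     = (\<Sum>i\<le>k. (if i \<le> m then (-1) ^ i * coeff (P * ?C ^ (k - i)) (m - i) else 0) * S i)" for P m
  proof -
    have "P * (\<Sum>i\<le>k. smult (S i) (monom ((-1) ^ i) i * ?C ^ (k - i)))
      = (\<Sum>i\<le>k. smult (S i) (monom ((-1) ^ i) i * (P * ?C ^ (k - i))))"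
      by (simp add: sum_distrib_left mult_ac)
    then show ?thesis
      by (simp only: coeff_sum coeff_smult coeff_monom_mult) (auto intro!: sum.cong)
  qed
  show ?thesis
  proof (cases "k \<le> n - h")
    case True
    \<comment> \<open>In this case all of \<open>(?A * ?B) ^ k\<close> divides the right side and
      cancels in the integral domain of polynomials.\<close>
    have "?B ^ (n - h) = ?B ^ k * ?B ^ (n - h - k)"
      using True by (simp only: le_add_diff_inverse flip: power_add)
    then have "(?A * ?B) ^ k * ?V = (?A * ?B) ^ k * (?A ^ (h - k) * ?B ^ (n - h - k)
        * (\<Sum>i\<le>k. smult (S i) (monom ((-1) ^ i) i * ?C ^ (k - i))))"
      unfolding eq Ah by (simp only: power_mult_distrib mult_ac)
    then have "?V = ?A ^ (h - k) * ?B ^ (n - h - k)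
        * (\<Sum>i\<le>k. smult (S i) (monom ((-1) ^ i) i * ?C ^ (k - i)))"
      by (rule iffD1[OF mult_left_cancel, rotated]) (simp only: mult_eq_0_iff power_eq_0_iff A0 B0 simp_thms)
    then have "coeff ?V j = (\<Sum>i\<le>k. (if i \<le> j then (-1) ^ i * coeff (?A ^ (h - k) * ?B ^ (n - h - k) * ?C ^ (k - i)) (j - i) else 0) * S i)"
      by (simp only: trm)
    moreover have "(if i \<le> j then (-1) ^ i * coeff (?A ^ (h - k) * ?B ^ (n - h - k) * ?C ^ (k - i)) (j - i) else 0)
       = rcoef q n h k i j" if "i \<le> k" for i
    proof -
      have "coeff (?A ^ (h - k) * ?B ^ (n - h - k) * ?C ^ (k - i)) (j - i)
         = (\<Sum>l=0..j - i. krawtchouk q (j - i - l) (of_nat h - of_nat k) (of_nat n - 2 * of_nat k)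
          * (of_nat q - 2) ^ l * ((of_nat k - of_nat i) gchoose l))"
      proof -
        have kr: "krawtchouk q m (of_nat h - of_nat k) (of_nat n - 2 * of_nat k)
          = coeff (?A ^ (h - k) * ?B ^ (n - h - k)) m" for m
        proof -
          have "(of_nat n - 2 * of_nat k) - of_nat (h - k) = (of_nat (n - h - k) :: complex)"
            using True kh hn by (simp add: of_nat_diff)
          from krawtchouk_eq_coeff[OF this, of q m] show ?thesis
            using kh by (simp add: of_nat_diff)
        qed
        have ki: "of_nat k - of_nat i = (of_nat (k - i) :: complex)"
          using that by (simp add: of_nat_diff)
        show ?thesis
          unfolding mult.commute[of _ "?C ^ (k - i)"]
          unfolding coeff_mult[of "?C ^ (k - i)"] coeff_one_linear_power kr ki
          by (rule sum.cong) (auto simp: mult_ac)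
      qed
      then show ?thesis using True by (simp add: rcoef_def)
    qed
    ultimately show ?thesis using jn by (simp add: coeff_sum_monom)
  next
    case False
    \<comment> \<open>Only \<open>?A ^ k * ?B ^ (n - h)\<close> cancels now; \<open>r\<close> is the
      exponent of \<open>?B\<close> remaining on the left, and \<open>w\<close> gives the
      coefficients of the remaining right side.\<close>
    define r where "r = h + k - n"
    define w where "w m = coeff (?A ^ (h - k) * (\<Sum>i\<le>k. smult (S i) (monom ((-1) ^ i) i * ?C ^ (k - i)))) m" for m
    let ?N = "n - k + 1"
    have "?B ^ k = ?B ^ (n - h) * ?B ^ r"
      using False hn by (subst power_add[symmetric]) (simp add: r_def)
    then have "(?A ^ k * ?B ^ (n - h)) * (?B ^ r * ?V) = (?A ^ k * ?B ^ (n - h)) * (?A ^ (h - k)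
        * (\<Sum>i\<le>k. smult (S i) (monom ((-1) ^ i) i * ?C ^ (k - i))))"
      using eq unfolding Ah by (simp only: power_mult_distrib mult_ac)
    then have "?B ^ r * ?V = ?A ^ (h - k) * (\<Sum>i\<le>k. smult (S i) (monom ((-1) ^ i) i * ?C ^ (k - i)))"
      by (rule iffD1[OF mult_left_cancel, rotated]) (simp only: mult_eq_0_iff power_eq_0_iff A0 B0 simp_thms)
    then have w: "w m = coeff (?V * ?B ^ r) m" for m
      by (simp only: w_def mult.commute)
    have w1: "w m = (\<Sum>b\<le>m. V b * ((of_nat q - 1) ^ (m - b) * of_nat (r choose (m - b))))" if "m \<le> n" for m
      unfolding w coeff_mult coeff_one_linear_power
      by (rule sum.cong) (use that in \<open>auto simp: coeff_sum_monom binomial_gbinomial\<close>)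
    let ?U = "umat q n h k" and ?I = "umat_inv q n h k"
    have Uc: "?U \<in> carrier_mat ?N ?N" by (simp add: umat_def)
    note Ic = umat_inv(1)[of q n h k]
    \<comment> \<open>Row \<open>a\<close> is the convolution formula for \<open>w a\<close>.
      Truncation at degree \<open>n - k\<close> is harmless, since \<open>w a\<close> involves only
      \<open>V b\<close> with \<open>b \<le> a\<close>.\<close>
    have UV: "?U *\<^sub>v vec ?N V = vec ?N w"
    proof (rule eq_vecI)
      fix a assume "a < dim_vec (vec ?N w)"
      then have a: "a < ?N" by simp
      have "(?U *\<^sub>v vec ?N V) $ a = (\<Sum>b<?N. ?U $$ (a, b) * V b)"
        using a Uc by (auto simp: scalar_prod_def lessThan_atLeast0 intro!: sum.cong)
      also have "\<dots> = (\<Sum>b\<le>a. ?U $$ (a, b) * V b)"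
        by (rule sum.mono_neutral_right) (use a in \<open>auto simp: umat_def\<close>)
      also have "\<dots> = w a"
        using a by (subst w1) (auto simp: umat_def r_def intro!: sum.cong)
      finally show "(?U *\<^sub>v vec ?N V) $ a = vec ?N w $ a" using a by simp
    qed (use Uc in simp)
    have "vec ?N V = (?I * ?U) *\<^sub>v vec ?N V"
      by (simp add: umat_inv(3)[of q n h k])
    also have "\<dots> = ?I *\<^sub>v vec ?N w"
      by (subst assoc_mult_mat_vec[OF Ic Uc]) (simp_all only: UV vec_carrier)
    finally have "V j = (?I *\<^sub>v vec ?N w) $ j"
      using j by (metis index_vec less_Suc_eq_le Suc_eq_plus1)
    also have "\<dots> = (\<Sum>s<?N. ?I $$ (j, s) * w s)"
      using j Ic by (auto simp: scalar_prod_def lessThan_atLeast0 intro!: sum.cong)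
    finally have Vj: "V j = (\<Sum>s<?N. ?I $$ (j, s) * w s)" .
    also have "\<dots> = (\<Sum>s\<le>j. ?I $$ (j, s) * w s)"
      by (rule sum.mono_neutral_right) (use j in \<open>auto simp: umat_inv_above_diagonal\<close>)
    also have "\<dots> = (\<Sum>s\<le>j. \<Sum>i\<le>k. (if i \<le> s then (-1) ^ i * ?I $$ (j, s) * coeff (?A ^ (h - k) * ?C ^ (k - i)) (s - i) else 0) * S i)"
      unfolding w_def trm unfolding sum_distrib_left by (intro sum.cong) auto
    also have "\<dots> = (\<Sum>i\<le>k. \<Sum>s\<le>j. (if i \<le> s then (-1) ^ i * ?I $$ (j, s) * coeff (?A ^ (h - k) * ?C ^ (k - i)) (s - i) else 0) * S i)"
      by (rule sum.swap)
    also have "\<dots> = (\<Sum>i\<le>k. rcoef q n h k i j * S i)"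
    proof (rule sum.cong[OF refl])
      fix i assume "i \<in> {..k}"
      then have i: "i \<le> k" by simp
      \<comment> \<open>\<open>?C\<close> is the Krawtchouk factor for \<open>q - 1\<close> letters,
        as \<open>(q - 1) - 1 = q - 2\<close>; the arguments \<open>h - k\<close> and
        \<open>h - i\<close> differ by \<open>k - i\<close>, the exponent of
        \<open>?C\<close>.\<close>
      have kr: "krawtchouk (q - 1) m (of_nat h - of_nat k) (of_nat h - of_nat i)
          = coeff (?A ^ (h - k) * ?C ^ (k - i)) m" for m
      proof -
        have "(of_nat h - of_nat i) - of_nat (h - k) = (of_nat (k - i) :: complex)"
          using i kh by (simp add: of_nat_diff)
        from krawtchouk_eq_coeff[OF this, of "q - 1" m] show ?thesis
          using kh \<open>q \<ge> 1\<close> by (simp add: of_nat_diff diff_diff_eq)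
      qed
      have "(\<Sum>s\<le>j. (if i \<le> s then (-1) ^ i * ?I $$ (j, s) * coeff (?A ^ (h - k) * ?C ^ (k - i)) (s - i) else 0))
        = (\<Sum>s=i..j. (-1) ^ i * ?I $$ (j, s) * coeff (?A ^ (h - k) * ?C ^ (k - i)) (s - i))"
        by (rule sum.mono_neutral_cong_right) auto
      also have "\<dots> = rcoef q n h k i j"
        unfolding kr[symmetric] using False by (simp add: rcoef_def sum_distrib_left mult_ac)
      finally show "(\<Sum>s\<le>j. (if i \<le> s then (-1) ^ i * ?I $$ (j, s) * coeff (?A ^ (h - k) * ?C ^ (k - i)) (s - i) else 0) * S i)
         = rcoef q n h k i j * S i"
        by (simp only: flip: sum_distrib_right)
    qed
    finally show ?thesis .
  qed
qed

section \<open>Spectrum of lambda-functions and the local relation\<close>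

lemma hvert_eq_cube: "hvert q n = cube {..<n} q"
  by (simp add: hvert_def cube_def)

lemma hsphere_eq: "hsphere q n i \<alpha> = {\<beta> \<in> cube {..<n} q. dist_on {..<n} \<alpha> \<beta> = i}"
  by (simp add: hsphere_def hvert_eq_cube hdist_def dist_on_def)

text \<open>Adjacency has eigenvalue \<open>(q - 1) * n - q * w\<close> on a character of weight
  \<open>w\<close>. Comparing with \<open>lam\<close> shows that the transform is annihilated by
  \<open>q * (h - w)\<close>.\<close>

lemma fourier_lambda_function:
  assumes f: "lambda_function q n lam f" and lam: "lam = (of_nat q - 1) * of_nat n - of_nat q * of_nat h"
    and q: "q \<ge> 1" and n: "n \<ge> 1" and z: "z \<in> cube {..<n} q" and "wt_on {..<n} z \<noteq> h"
  shows "fourier {..<n} q f z = 0"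
proof -
  let ?D = "{..<n}" and ?w = "wt_on {..<n} z"
  let ?K = "\<lambda>\<alpha> \<beta>. if dist_on ?D \<alpha> \<beta> = 1 then 1 else (0::complex)"
  let ?e = "krawtchouk q 1 (of_nat ?w) (of_nat n)"
  have restr: "(\<Sum>\<beta>\<in>cube ?D q. (if P \<beta> then 1 else 0) * G \<beta>) = (\<Sum>\<beta> | \<beta> \<in> cube ?D q \<and> P \<beta>. G \<beta>)"
    for P and G :: "_ \<Rightarrow> complex"
    by (rule sum.mono_neutral_cong_right) (auto simp: finite_cube)
  have "fourier ?D q (\<lambda>\<alpha>. \<Sum>\<beta>\<in>cube ?D q. ?K \<alpha> \<beta> * f \<beta>) z = ?e * fourier ?D q f z"
    by (rule fourier_kernel) (use n sphere_sum_chr[OF _ z] in \<open>simp_all only: restr finite_lessThan card_lessThan\<close>)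
  moreover have "fourier ?D q (\<lambda>\<alpha>. \<Sum>\<beta>\<in>cube ?D q. ?K \<alpha> \<beta> * f \<beta>) z = lam * fourier ?D q f z"
    unfolding restr fourier_def sum_distrib_left
    by (rule sum.cong) (use f in \<open>auto simp: lambda_function_def hsphere_eq hvert_eq_cube\<close>)
  ultimately have "(?e - lam) * fourier ?D q f z = 0"
    by (simp add: algebra_simps)
  moreover have "?e - lam = of_nat q * (of_nat h - of_nat ?w)"
    by (simp add: krawtchouk_def lam algebra_simps)
  moreover have "of_nat q * (of_nat h - of_nat ?w) \<noteq> (0::complex)"
    using assms by simp
  ultimately show ?thesis by (metis mult_eq_0_iff)
qed

text \<open>This is the relation \<open>V_j = \<Sum>i. r_ij S_i\<close>. By
  \<open>rcoef_solve\<close> it follows from an identity of generating polynomials, which is checked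
  at each value of \<open>x\<close>.\<close>

lemma local_relation:
  assumes f: "lambda_function q n lam f" and lam: "lam = (of_nat q - 1) * of_nat n - of_nat q * of_nat h"
    and q: "q \<ge> 1" and n: "n \<ge> 1" and hn: "h \<le> n"
    and J: "J \<subseteq> {..<n}" and k: "card J = k" and kh: "k \<le> h" and j: "j \<le> n - k"
    and \<alpha>: "\<alpha> \<in> hvert q n"
  shows "(\<Sum>\<beta> | \<beta> \<in> hsphere q n j \<alpha> \<and> (\<forall>i\<in>J. \<beta> i = \<alpha> i). f \<beta>)
    = (\<Sum>i\<le>k. rcoef q n h k i j * (\<Sum>\<beta> | \<beta> \<in> hsphere q n i \<alpha> \<and> (\<forall>i\<in>{..<n} - J. \<beta> i = \<alpha> i). f \<beta>))"
proof (rule rcoef_solve[OF q kh hn j])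
  let ?D = "{..<n}" and ?P = "cube {..<n} q"
  have \<alpha>P: "\<alpha> \<in> ?P" using \<alpha> by (simp add: hvert_eq_cube)
  have fD: "finite ?D" and fJ: "finite J" using J finite_subset by auto
  define V where "V m = (\<Sum>\<beta> | \<beta> \<in> hsphere q n m \<alpha> \<and> (\<forall>i\<in>J. \<beta> i = \<alpha> i). f \<beta>)" for m
  define S where "S m = (\<Sum>\<beta> | \<beta> \<in> hsphere q n m \<alpha> \<and> (\<forall>i\<in>?D - J. \<beta> i = \<alpha> i). f \<beta>)" for m
  let ?A = "[:1, -1:] :: complex poly" and ?B = "[:1, of_nat q - 1:] :: complex poly"
    and ?C = "[:1, of_nat q - 2:] :: complex poly"
  have *: "poly ((?A * ?B) ^ k * (\<Sum>m\<le>n. monom (V m) m)) x = poly (?A ^ h * ?B ^ (n - h)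
      * (\<Sum>i\<le>k. smult (S i) (monom ((-1) ^ i) i * ?C ^ (k - i)))) x" for x
  proof -
    \<comment> \<open>The left kernel forces agreement on \<open>J\<close> and counts disagreements
      off \<open>J\<close> by \<open>x\<close>. The right one forces agreement off \<open>J\<close>;
      on \<open>J\<close> it gives \<open>- x\<close> for a disagreement and
      \<open>1 + (q - 2) * x\<close> for an agreement.\<close>
    define ul vl ur vr :: "nat \<Rightarrow> complex" where "ul i = 1" and "vl i = (if i \<in> J then 0 else x)"
      and "ur i = (if i \<in> J then 1 + (of_nat q - 2) * x else 1)" and "vr i = (if i \<in> J then - x else 0)" for i
    let ?K = "\<lambda>u v \<alpha> \<beta>. \<Prod>i\<in>?D. if \<alpha> i = \<beta> i then u i else (v i :: complex)"
    let ?T = "\<lambda>u v \<alpha>. \<Sum>\<beta>\<in>?P. ?K u v \<alpha> \<beta> * f \<beta>"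
    let ?a = "1 - x" and ?b = "1 + (of_nat q - 1) * x" and ?c = "1 + (of_nat q - 2) * x"
    \<comment> \<open>As a function of the centre, the left side is defined at every vertex, so it
      vanishes once its transform does.\<close>
    have "(?a * ?b) ^ k * ?T ul vl \<alpha> - ?a ^ h * ?b ^ (n - h) * ?T ur vr \<alpha> = 0"
    proof (rule fourier_inj[OF fD _ \<alpha>P])
      fix z assume z: "z \<in> ?P"
      \<comment> \<open>Both kernels act diagonally on characters, and after clearing denominators their eigenvalues
        agree coordinate by coordinate.\<close>
      let ?e = "\<lambda>u v. \<Prod>i\<in>?D. if z i = 0 then u i + (of_nat q - 1) * v i else u i - (v i :: complex)"
      have T: "fourier ?D q (?T u v) z = ?e u v * fourier ?D q f z" for u v
        by (rule fourier_kernel[OF fD]) (rule chr_product_kernel[OF fD z])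
      have "fourier ?D q (\<lambda>\<alpha>. (?a * ?b) ^ k * ?T ul vl \<alpha> - ?a ^ h * ?b ^ (n - h) * ?T ur vr \<alpha>) z
        = (?a * ?b) ^ k * fourier ?D q (?T ul vl) z - ?a ^ h * ?b ^ (n - h) * fourier ?D q (?T ur vr) z"
        by (rule fourier_diff_scale)
      also have "\<dots> = ((?a * ?b) ^ k * ?e ul vl - ?a ^ h * ?b ^ (n - h) * ?e ur vr) * fourier ?D q f z"
        unfolding T by (simp only: left_diff_distrib mult.assoc)
      also have "\<dots> = 0"
      proof (cases "wt_on ?D z = h")
        case True
        have "(?a * ?b) ^ k = (\<Prod>i\<in>?D. if i \<in> J then ?a * ?b else 1)"
        proof -
          have "{i\<in>?D. i \<in> J} = J" using J by auto
          then show ?thesis by (simp only: prod_if_const[OF fD] k power_one mult_1_right)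
        qed
        \<comment> \<open>Weight \<open>h\<close> enters here: \<open>z\<close> has
          \<open>n - h\<close> zeros, each contributing a factor \<open>?b\<close>.\<close>
        moreover have "?a ^ h * ?b ^ (n - h) = (\<Prod>i\<in>?D. if z i = 0 then ?b else ?a)"
          using card_zeros[OF fD, of z] True
          by (simp add: prod_if_const fD wt_on_def mult.commute)
        \<comment> \<open>On \<open>J\<close> the eigenvalue factor is 1 on the left and, on the
          right, \<open>?a\<close> where \<open>z i = 0\<close> and \<open>?b\<close> elsewhere. Off
          \<open>J\<close> it is \<open>?b\<close> or \<open>?a\<close>, respectively, on the left
          and 1 on the right.\<close>
        moreover have "(\<Prod>i\<in>?D. if i \<in> J then ?a * ?b else 1) * ?e ul vl
            = (\<Prod>i\<in>?D. if z i = 0 then ?b else ?a) * ?e ur vr"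
          unfolding prod.distrib[symmetric]
          by (rule prod.cong) (auto simp: ul_def vl_def ur_def vr_def algebra_simps)
        ultimately show ?thesis by simp
      next
        case False
        then show ?thesis using fourier_lambda_function[OF f lam q n z] by simp
      qed
      finally show "fourier ?D q (\<lambda>\<alpha>. (?a * ?b) ^ k * ?T ul vl \<alpha> - ?a ^ h * ?b ^ (n - h) * ?T ur vr \<alpha>) z = 0" .
    qed
    moreover have "?T ul vl \<alpha> = poly (\<Sum>m\<le>n. monom (V m) m) x"
    proof -
      let ?G = "\<lambda>\<beta>. if \<forall>i\<in>J. \<beta> i = \<alpha> i then f \<beta> else 0"
      have "?K ul vl \<alpha> \<beta> * f \<beta> = x ^ dist_on ?D \<beta> \<alpha> * ?G \<beta>" for \<beta>
      proof (cases "\<forall>i\<in>J. \<beta> i = \<alpha> i")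
        case True
        then have "?K ul vl \<alpha> \<beta> = (\<Prod>i\<in>?D. if \<alpha> i = \<beta> i then 1 else x)"
          by (intro prod.cong) (auto simp: ul_def vl_def)
        also have "\<dots> = x ^ dist_on ?D \<beta> \<alpha>"
          by (simp add: prod_if_const fD dist_on_def eq_commute)
        finally show ?thesis using True by simp
      next
        case False
        then obtain i where "i \<in> J" "\<alpha> i \<noteq> \<beta> i" by force
        then have "?K ul vl \<alpha> \<beta> = 0"
          using J by (intro prod_zero[OF fD]) (auto simp: vl_def intro!: bexI[of _ i])
        then show ?thesis using False by auto
      qed
      then have "?T ul vl \<alpha> = (\<Sum>\<beta>\<in>?P. x ^ dist_on ?D \<beta> \<alpha> * ?G \<beta>)" by (simp only:)
      also have "\<dots> = poly (\<Sum>m\<le>n. monom (\<Sum>\<beta> | \<beta> \<in> ?P \<and> dist_on ?D \<beta> \<alpha> = m. ?G \<beta>) m) x"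
        using sum_sphere_power[OF fD, of x \<alpha> ?G q] by simp
      also have "(\<lambda>m. \<Sum>\<beta> | \<beta> \<in> ?P \<and> dist_on ?D \<beta> \<alpha> = m. ?G \<beta>) = V"
        unfolding V_def hsphere_eq
        by (rule ext, rule sum.mono_neutral_cong_right)
          (auto simp: finite_cube dist_on_commute)
      finally show ?thesis .
    qed
    \<comment> \<open>A vertex at distance \<open>i\<close> that agrees with \<open>\<alpha>\<close>
      off \<open>J\<close> agrees in \<open>k - i\<close> coordinates of \<open>J\<close>, whence
      the power of \<open>?c\<close>.\<close>
    moreover have "?T ur vr \<alpha> = poly (\<Sum>i\<le>k. smult (S i) (monom ((-1) ^ i) i * ?C ^ (k - i))) x"
    proof -
      let ?Q = "{\<beta> \<in> ?P. \<forall>i\<in>?D - J. \<beta> i = \<alpha> i}"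
      have distQ: "dist_on ?D \<alpha> \<beta> = card {i\<in>J. \<alpha> i \<noteq> \<beta> i}" if "\<forall>i\<in>?D - J. \<beta> i = \<alpha> i" for \<beta>
        unfolding dist_on_def by (rule arg_cong[of _ _ card]) (use that J in force)
      have K: "?K ur vr \<alpha> \<beta> = (- x) ^ dist_on ?D \<alpha> \<beta> * ?c ^ (k - dist_on ?D \<alpha> \<beta>)"
        if \<beta>: "\<forall>i\<in>?D - J. \<beta> i = \<alpha> i" for \<beta>
      proof -
        have "?K ur vr \<alpha> \<beta> = (\<Prod>i\<in>J. if \<alpha> i = \<beta> i then ?c else - x)"
          by (rule prod.mono_neutral_cong_right) (use J \<beta> in \<open>auto simp: ur_def vr_def\<close>)
        moreover have "card {i\<in>J. \<alpha> i = \<beta> i} = k - card {i\<in>J. \<alpha> i \<noteq> \<beta> i}"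
        proof -
          have "{i\<in>J. \<alpha> i = \<beta> i} = J - {i\<in>J. \<alpha> i \<noteq> \<beta> i}" by auto
          then show ?thesis using fJ k by (simp add: card_Diff_subset)
        qed
        ultimately show ?thesis by (simp add: prod_if_const fJ distQ[OF \<beta>] mult.commute)
      qed
      have "?T ur vr \<alpha> = (\<Sum>\<beta>\<in>?Q. (- x) ^ dist_on ?D \<alpha> \<beta> * ?c ^ (k - dist_on ?D \<alpha> \<beta>) * f \<beta>)"
      proof (rule sum.mono_neutral_cong_right)
        show "\<forall>\<beta>\<in>?P - ?Q. ?K ur vr \<alpha> \<beta> * f \<beta> = 0"
        proof
          fix \<beta> assume "\<beta> \<in> ?P - ?Q"
          then obtain i where "i \<in> ?D - J" "\<alpha> i \<noteq> \<beta> i" by force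
          then have "?K ur vr \<alpha> \<beta> = 0"
            by (intro prod_zero[OF fD]) (auto simp: vr_def intro!: bexI[of _ i])
          then show "?K ur vr \<alpha> \<beta> * f \<beta> = 0" by simp
        qed
      qed (simp_all add: finite_cube K)
      also have "\<dots> = (\<Sum>i\<le>k. \<Sum>\<beta> | \<beta> \<in> ?Q \<and> dist_on ?D \<alpha> \<beta> = i.
          (- x) ^ dist_on ?D \<alpha> \<beta> * ?c ^ (k - dist_on ?D \<alpha> \<beta>) * f \<beta>)"
      proof (rule sum.group[symmetric])
        show "dist_on ?D \<alpha> ` ?Q \<subseteq> {..k}"
          using fJ by (auto simp: distQ simp flip: k intro!: card_mono)
      qed (simp_all add: finite_cube)
      also have "\<dots> = (\<Sum>i\<le>k. (- x) ^ i * ?c ^ (k - i) * S i)"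
        unfolding S_def hsphere_eq sum_distrib_left by (intro sum.cong) auto
      also have "\<dots> = poly (\<Sum>i\<le>k. smult (S i) (monom ((-1) ^ i) i * ?C ^ (k - i))) x"
        by (simp add: poly_sum poly_monom power_minus[of x] mult_ac)
      finally show ?thesis .
    qed
    moreover have "poly ?A x = ?a" "poly ?B x = ?b" by simp_all
    ultimately show ?thesis by (simp only: poly_mult poly_power right_minus_eq)
  qed
  show "(?A * ?B) ^ k * (\<Sum>m\<le>n. monom (\<Sum>\<beta> | \<beta> \<in> hsphere q n m \<alpha> \<and> (\<forall>i\<in>J. \<beta> i = \<alpha> i). f \<beta>) m)
     = ?A ^ h * ?B ^ (n - h) * (\<Sum>i\<le>k. smult (\<Sum>\<beta> | \<beta> \<in> hsphere q n i \<alpha> \<and> (\<forall>i\<in>{..<n} - J. \<beta> i = \<alpha> i). f \<beta>)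
       (monom ((-1) ^ i) i * ?C ^ (k - i)))"
    unfolding V_def[symmetric] S_def[symmetric] by (rule iffD1[OF poly_eq_poly_eq_iff], rule ext, rule *)
qed

section \<open>Propagation from weight d to all smaller weights\<close>

lemma lambda_function_diff:
  "lambda_function q n lam f \<Longrightarrow> lambda_function q n lam g \<Longrightarrow> lambda_function q n lam (\<lambda>\<alpha>. f \<alpha> - g \<alpha>)"
  by (simp add: lambda_function_def sum_subtractf right_diff_distrib)

lemma hsphere_hzero: "hsphere q n i (hzero n) = {\<beta> \<in> cube {..<n} q. wt_on {..<n} \<beta> = i}"
proof -
  have "dist_on {..<n} (hzero n) \<beta> = wt_on {..<n} \<beta>" for \<beta>
    unfolding dist_on_def wt_on_def hzero_def by (rule arg_cong[of _ _ card]) auto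
  then show ?thesis by (simp add: hsphere_eq)
qed

lemma lambda_function_vanish:
  assumes q: "q > 2" and n: "n \<ge> 1" and hn: "h \<le> n"
    and lam: "lam = (of_nat q - 1) * of_nat n - of_nat q * of_nat h"
    and dh: "d \<le> h"
    and ev: "\<And>k l. k \<le> d \<Longrightarrow> l \<le> k \<Longrightarrow>
           (\<Sum>i=0..k. rcoef q n h k i (d - k) * krawtchouk (q - 1) i (of_nat l) (of_nat k)) \<noteq> 0"
    and u: "lambda_function q n lam u" and u0: "\<forall>\<alpha>\<in>hsphere q n d (hzero n). u \<alpha> = 0"
  shows "k \<le> d \<Longrightarrow> \<alpha> \<in> hsphere q n k (hzero n) \<Longrightarrow> u \<alpha> = 0"
proof (induction k arbitrary: \<alpha> rule: less_induct)
  case (less k)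
  let ?D = "{..<n}"
  have \<alpha>: "\<alpha> \<in> cube ?D q" "wt_on ?D \<alpha> = k" using less.prems by (auto simp: hsphere_hzero)
  define J where "J = {i\<in>?D. \<alpha> i \<noteq> 0}"
  have J: "J \<subseteq> ?D" and k: "card J = k" and fJ: "finite J"
    using \<alpha> by (auto simp: J_def wt_on_def)
  \<comment> \<open>Shifting letters by one identifies words on \<open>J\<close> over
    \<open>q - 1\<close> letters with the vertices of support exactly \<open>J\<close>, whose
    letters on \<open>J\<close> are nonzero.\<close>
  define emb :: "(nat \<Rightarrow> nat) \<Rightarrow> nat \<Rightarrow> nat" where
    "emb \<gamma> = (\<lambda>i\<in>?D. if i \<in> J then Suc (\<gamma> i) else 0)" for \<gamma>
  have emb_J: "emb \<gamma> i = Suc (\<gamma> i)" if "i \<in> J" for \<gamma> i using that J by (auto simp: emb_def)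
  have emb_0: "emb \<gamma> i = 0" if "i \<in> ?D - J" for \<gamma> i using that by (auto simp: emb_def)
  have emb_cube: "emb \<gamma> \<in> cube ?D q" if "\<gamma> \<in> cube J (q - 1)" for \<gamma>
    using that q by (auto simp: cube_def emb_def PiE_def Pi_def extensional_def)
  have emb_surj: "\<exists>\<gamma>\<in>cube J (q - 1). \<beta> = emb \<gamma>"
    if \<beta>: "\<beta> \<in> cube ?D q" and nz: "\<forall>i\<in>J. \<beta> i \<noteq> 0" and z: "\<forall>i\<in>?D - J. \<beta> i = 0" for \<beta>
  proof
    let ?\<gamma> = "\<lambda>i\<in>J. \<beta> i - 1"
    show "?\<gamma> \<in> cube J (q - 1)"
    proof -
      have "\<beta> i - 1 < q - 1" if "i \<in> J" for i
      proof -
        have "\<beta> i < q" using \<beta> that J by (auto simp: cube_def)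
        then show ?thesis using nz that by (simp add: diff_less_mono Suc_leI)
      qed
      then show ?thesis by (auto simp: cube_def)
    qed
    show "\<beta> = emb ?\<gamma>"
    proof
      fix i
      show "\<beta> i = emb ?\<gamma> i"
      proof (cases "i \<in> ?D")
        case True
        then show ?thesis using nz z by (auto simp: emb_def)
      next
        case False
        then show ?thesis using \<beta> by (auto simp: emb_def cube_def PiE_def extensional_def)
      qed
    qed
  qed
  have emb_inj: "inj_on emb (cube J (q - 1))"
  proof (rule inj_onI)
    fix \<gamma> \<delta> assume *: "\<gamma> \<in> cube J (q - 1)" "\<delta> \<in> cube J (q - 1)" "emb \<gamma> = emb \<delta>"
    show "\<gamma> = \<delta>"
    proof (rule PiE_ext)
      show "\<gamma> \<in> J \<rightarrow>\<^sub>E {..<q - 1}" "\<delta> \<in> J \<rightarrow>\<^sub>E {..<q - 1}" using * by (simp_all add: cube_def)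
      fix i assume "i \<in> J"
      then show "\<gamma> i = \<delta> i" using emb_J[of i] *(3) by (metis nat.inject)
    qed
  qed
  have emb_dist: "dist_on ?D (emb \<gamma>) (emb \<delta>) = dist_on J \<gamma> \<delta>" for \<gamma> \<delta>
    unfolding dist_on_def by (rule arg_cong[of _ _ card]) (use J in \<open>auto simp: emb_def\<close>)
  have "\<exists>\<gamma>\<in>cube J (q - 1). \<alpha> = emb \<gamma>"
    by (rule emb_surj[OF \<alpha>(1)]) (simp_all add: J_def)
  then obtain \<gamma>0 where \<gamma>0: "\<gamma>0 \<in> cube J (q - 1)" "\<alpha> = emb \<gamma>0"
    by blast
  \<comment> \<open>Injectivity of the operator requires its sum to vanish around every vertex of
    support \<open>J\<close>, not only around \<open>\<alpha>\<close>; hence the arbitrary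
    \<open>\<gamma>\<close> below.\<close>
  have "u (emb \<gamma>0) = 0"
  proof (rule sphere_combination_inj[OF fJ, where p = "q - 1" and c = "\<lambda>i. rcoef q n h k i (d - k)" and F = "\<lambda>\<gamma>. u (emb \<gamma>)"])
    show "(\<Sum>i\<le>card J. rcoef q n h k i (d - k) * krawtchouk (q - 1) i (of_nat l) (of_nat (card J))) \<noteq> 0"
      if "l \<le> card J" for l
      using ev[of k l] that less.prems(1) by (simp add: k atLeast0AtMost)
    show "\<gamma>0 \<in> cube J (q - 1)" by (rule \<gamma>0)
    fix \<gamma> assume \<gamma>: "\<gamma> \<in> cube J (q - 1)"
    \<comment> \<open>Such a \<open>\<beta>\<close> differs from \<open>emb \<gamma>\<close> only
      off \<open>J\<close>, where \<open>emb \<gamma>\<close> is 0, so the \<open>d - k\<close>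
      differences raise the weight from \<open>k\<close> to \<open>d\<close>.\<close>
    have "(\<Sum>\<beta> | \<beta> \<in> hsphere q n (d - k) (emb \<gamma>) \<and> (\<forall>i\<in>J. \<beta> i = emb \<gamma> i). u \<beta>) = 0"
    proof (rule sum.neutral, rule ballI)
      fix \<beta> assume "\<beta> \<in> {\<beta>. \<beta> \<in> hsphere q n (d - k) (emb \<gamma>) \<and> (\<forall>i\<in>J. \<beta> i = emb \<gamma> i)}"
      then have \<beta>: "\<beta> \<in> cube ?D q" "dist_on ?D (emb \<gamma>) \<beta> = d - k" "\<forall>i\<in>J. \<beta> i = emb \<gamma> i"
        by (auto simp: hsphere_eq)
      have "{i\<in>?D. \<beta> i \<noteq> 0} = J \<union> {i\<in>?D. emb \<gamma> i \<noteq> \<beta> i}"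
        using J \<beta>(3) emb_J emb_0 by fastforce
      moreover have "J \<inter> {i\<in>?D. emb \<gamma> i \<noteq> \<beta> i} = {}" using \<beta>(3) by auto
      ultimately have "wt_on ?D \<beta> = k + (d - k)"
        using fJ \<beta>(2) by (simp add: wt_on_def dist_on_def card_Un_disjoint k)
      then show "u \<beta> = 0" using u0 \<beta>(1) less.prems(1) by (simp add: hsphere_hzero)
    qed
    \<comment> \<open>Here the support of \<open>\<beta>\<close> lies in \<open>J\<close>. If it is
      a proper subset, the weight is below \<open>k\<close> and the induction hypothesis removes the
      term; otherwise \<open>\<beta>\<close> is in the image of \<open>emb\<close>.\<close>
    moreover have "(\<Sum>\<beta> | \<beta> \<in> hsphere q n i (emb \<gamma>) \<and> (\<forall>i\<in>?D - J. \<beta> i = emb \<gamma> i). u \<beta>)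
      = (\<Sum>\<delta> | \<delta> \<in> cube J (q - 1) \<and> dist_on J \<gamma> \<delta> = i. u (emb \<delta>))" (is "sum u ?T = sum _ ?R") for i
    proof -
      have "sum u ?T = sum u (emb ` ?R)"
      proof (rule sum.mono_neutral_right)
        show "finite ?T" by (simp add: hsphere_eq finite_cube)
        show "emb ` ?R \<subseteq> ?T" by (auto simp: hsphere_eq emb_cube emb_dist emb_0)
        show "\<forall>\<beta>\<in>?T - emb ` ?R. u \<beta> = 0"
        proof
          fix \<beta> assume b: "\<beta> \<in> ?T - emb ` ?R"
          then have \<beta>: "\<beta> \<in> cube ?D q" "dist_on ?D (emb \<gamma>) \<beta> = i" "\<forall>i\<in>?D - J. \<beta> i = 0"
            by (auto simp: hsphere_eq emb_0)
          have "\<exists>i\<in>J. \<beta> i = 0"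
          proof (rule ccontr)
            assume "\<not> ?thesis"
            then obtain \<delta> where "\<delta> \<in> cube J (q - 1)" "\<beta> = emb \<delta>"
              using emb_surj[OF \<beta>(1) _ \<beta>(3)] by auto
            then show False using b \<beta>(2) by (auto simp: emb_dist)
          qed
          moreover have "{i\<in>?D. \<beta> i \<noteq> 0} \<subseteq> J"
          proof
            fix x assume "x \<in> {i\<in>?D. \<beta> i \<noteq> 0}"
            then show "x \<in> J" using bspec[OF \<beta>(3), of x] by auto
          qed
          ultimately have "{i\<in>?D. \<beta> i \<noteq> 0} \<subset> J" by blast
          then have "wt_on ?D \<beta> < k" unfolding wt_on_def k[symmetric] by (rule psubset_card_mono[OF fJ])
          then show "u \<beta> = 0"
            using less.IH[of "wt_on ?D \<beta>" \<beta>] less.prems(1) \<beta>(1) by (simp add: hsphere_hzero)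
        qed
      qed
      also have "\<dots> = (\<Sum>\<delta>\<in>?R. u (emb \<delta>))"
        by (rule sum.reindex_cong[OF inj_on_subset[OF emb_inj]]) auto
      finally show ?thesis .
    qed
    moreover have "d - k \<le> n - k" using dh hn by simp
    moreover have "k \<le> h" using less.prems(1) dh by simp
    ultimately show "(\<Sum>i\<le>card J. rcoef q n h k i (d - k) *
        (\<Sum>\<delta> | \<delta> \<in> cube J (q - 1) \<and> dist_on J \<gamma> \<delta> = i. u (emb \<delta>))) = 0"
      using local_relation[OF u lam _ n hn J k, of "d - k" "emb \<gamma>"] q emb_cube[OF \<gamma>]
      by (simp add: k hvert_eq_cube)
  qed
  then show ?case by (simp add: \<gamma>0)
qed

theorem theorem2:
  fixes q n h d :: nat
    and lam :: complex
    and \<phi> f g :: "(nat \<Rightarrow> nat) \<Rightarrow> complex"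
  assumes "q > 2" and "n \<ge> 1" and "h \<le> n"
    and "lam = (of_nat q - 1) * of_nat n - of_nat q * of_nat h"
    and "d \<le> h"
    and "\<And>k l. k \<le> d \<Longrightarrow> l \<le> k \<Longrightarrow>
           (\<Sum>i=0..k. rcoef q n h k i (d - k) * krawtchouk (q - 1) i (of_nat l) (of_nat k)) \<noteq> 0"
    and "lambda_function q n lam f" and "\<forall>\<alpha>\<in>hsphere q n d (hzero n). f \<alpha> = \<phi> \<alpha>"
    and "lambda_function q n lam g" and "\<forall>\<alpha>\<in>hsphere q n d (hzero n). g \<alpha> = \<phi> \<alpha>"
  shows "\<forall>\<alpha>\<in>hball q n d (hzero n). f \<alpha> = g \<alpha>"
proof
  fix \<alpha> assume "\<alpha> \<in> hball q n d (hzero n)"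
  then have "hdist n (hzero n) \<alpha> \<le> d" "\<alpha> \<in> hsphere q n (hdist n (hzero n) \<alpha>) (hzero n)"
    by (simp_all add: hball_def hsphere_def)
  moreover have "\<forall>\<alpha>\<in>hsphere q n d (hzero n). f \<alpha> - g \<alpha> = 0"
    using assms(8,10) by simp
  ultimately have "f \<alpha> - g \<alpha> = 0"
    using lambda_function_vanish[OF assms(1-6) lambda_function_diff[OF assms(7,9)]] by blast
  then show "f \<alpha> = g \<alpha>" by simp
qed

end
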